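(* Let $(T_r)_{r\in\mathbb{N}}$ be a family of sequential specifications and $(X_r)_{r\in\mathbb{N}}$ be a family of shared objects such that, for all $r$, $X_r$ is $SC(T_r)$-consistent. Let $H$ be a history, all of whose operations are operations on the objects $X_r$, that does not contain two operations $X_r.a$ (an operation on $X_r$) and $X_{r'}.b$ (an operation on $X_{r'}$) with $r>r'$ such that $X_r.a$ precedes $X_{r'}.b$ in the process order. Then $H$ is sequentially consistent with respect to the composition of all the $T_r$.
   Context: Histories. A history represents an execution of a system of finitely many sequential processes on shared objects. It contains a set of operations (each with its arguments and returned value, performed by one process on one object), partially ordered by the process order, i.e. the sequential order in which each process performs its own operations. Sequential specification. A sequential specification $T$ is a language, i.e. a set of finite and infinite words whose letters are operations. Linear extension. A linear extension of a history $H$ is a total order $\le$ on all the operations of $H$ that contains the process order and such that each operation $e$ has a finite past $\{e' : e' \le e\}$. Sequential consistency. $H \in SC(T)$ ($H$ is sequentially consistent with respect to $T$) if there exists a linear extension $\le$ of $H$ such that the word composed of all the operations of $H$ ordered by $\le$ belongs to $T$. Saying that $X_r$ is $SC(T_r)$-consistent means here that the sub-history of $H$ consisting of the operations on $X_r$ (with the induced process order) belongs to $SC(T_r)$. Composition. An interleaved sequence of words is a (finite or infinite) word composed of the disjoint union of all the letters of these words, the letters of each word appearing in the same order as in that word. The composition of the specifications $T_r$ is the set of all interleaved sequences of a family of words $(l_r)_{r\in\mathbb{N}}$ with $l_r\in T_r$ for each $r$. *)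

theory Defs
  imports Main
begin

datatype 'a word = Finite_Word "'a list" | Infinite_Word "nat \<Rightarrow> 'a"

fun positions :: "'a word \<Rightarrow> nat set" where
  "positions (Finite_Word xs) = {..<length xs}"
| "positions (Infinite_Word s) = UNIV"

fun letter :: "'a word \<Rightarrow> nat \<Rightarrow> 'a" where
  "letter (Finite_Word xs) n = xs ! n"
| "letter (Infinite_Word s) n = s n"

text \<open>
  The disjoint union of the letters of the words \<open>l r\<close> is the set of pairs \<open>(r, i)\<close> with \<open>i\<close> a
  position of \<open>l r\<close>; the map \<open>f\<close> says where each of these occurrences ends up in the interleaving.
\<close>
definition interleaving :: "(nat \<Rightarrow> 'a word) \<Rightarrow> 'a word \<Rightarrow> bool" where
  "interleaving l w \<longleftrightarrow>
     (\<exists>f. bij_betw f (SIGMA r:UNIV. positions (l r)) (positions w) \<and>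
          (\<forall>r. \<forall>i\<in>positions (l r). letter w (f (r, i)) = letter (l r) i) \<and>
          (\<forall>r. strict_mono_on (positions (l r)) (\<lambda>i. f (r, i))))"

definition composition :: "(nat \<Rightarrow> 'a word set) \<Rightarrow> 'a word set" where
  "composition T = {w. \<exists>l. (\<forall>r. l r \<in> T r) \<and> interleaving l w}"

record ('p, 'x, 'i, 'o) operation =
  op_process :: 'p
  op_object :: 'x
  op_invocation :: 'i
  op_result :: 'o

type_synonym ('p, 'x, 'i, 'o) seq_spec = "('p, 'x, 'i, 'o) operation word set"

text \<open>
  The same operation (same process, object, arguments and result) may be performed several times in
  a history. The elements of a history are therefore occurrences of operations, of an arbitrary type
  \<open>'e\<close>, and \<open>oper\<close> gives the operation that occurs. The invocation of an operation is its name
  together with its arguments.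
\<close>
record ('e, 'p, 'x, 'i, 'o) history =
  events :: "'e set"
  oper :: "'e \<Rightarrow> ('p, 'x, 'i, 'o) operation"
  process_order :: "'e rel"

text \<open>
  A process performs a finite or infinite sequence of operations: it is totally ordered by the
  process order, and only finitely many operations precede a given one. Operations of distinct
  processes are unrelated.
\<close>
definition is_history :: "('e, 'p, 'x, 'i, 'o) history \<Rightarrow> bool" where
  "is_history H \<longleftrightarrow>
     finite ((\<lambda>e. op_process (oper H e)) ` events H) \<and>
     partial_order_on (events H) (process_order H) \<and>
     (\<forall>a\<in>events H. \<forall>b\<in>events H.
        op_process (oper H a) = op_process (oper H b) \<longleftrightarrow>
        (a, b) \<in> process_order H \<or> (b, a) \<in> process_order H) \<and>
     (\<forall>e\<in>events H. finite {d. (d, e) \<in> process_order H})"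

definition subhistory :: "('e, 'p, 'x, 'i, 'o) history \<Rightarrow> 'x \<Rightarrow> ('e, 'p, 'x, 'i, 'o) history" where
  "subhistory H x =
     (let A = {e \<in> events H. op_object (oper H e) = x}
      in \<lparr>events = A, oper = oper H, process_order = Restr (process_order H) A\<rparr>)"

definition linear_extension :: "('e, 'p, 'x, 'i, 'o) history \<Rightarrow> 'e rel \<Rightarrow> bool" where
  "linear_extension H L \<longleftrightarrow>
     linear_order_on (events H) L \<and> process_order H \<subseteq> L \<and>
     (\<forall>e\<in>events H. finite {d. (d, e) \<in> L})"

text \<open>
  The element in position \<open>n\<close> (counting from 0) is the one with exactly \<open>n\<close> strict predecessors.
\<close>
definition event_at :: "('e, 'p, 'x, 'i, 'o) history \<Rightarrow> 'e rel \<Rightarrow> nat \<Rightarrow> 'e" where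
  "event_at H L n = (THE e. e \<in> events H \<and> card {d. (d, e) \<in> L \<and> d \<noteq> e} = n)"

definition word_of :: "('e, 'p, 'x, 'i, 'o) history \<Rightarrow> 'e rel \<Rightarrow> ('p, 'x, 'i, 'o) operation word" where
  "word_of H L =
     (if finite (events H)
      then Finite_Word (map (\<lambda>n. oper H (event_at H L n)) [0..<card (events H)])
      else Infinite_Word (\<lambda>n. oper H (event_at H L n)))"

definition SC :: "('p, 'x, 'i, 'o) seq_spec \<Rightarrow> ('e, 'p, 'x, 'i, 'o) history set" where
  "SC T = {H. is_history H \<and> (\<exists>L. linear_extension H L \<and> word_of H L \<in> T)}"

end

theory Submission
  imports Defs "HOL-Library.Nat_Bijection" "HOL-Library.Countable_Set"
begin

text \<open>
  Let \<open>L r\<close> be a linear extension of the operations on \<open>X r\<close> whose word lies in \<open>T r\<close>. Neither the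
  process order nor any \<open>L r\<close> ever leads from an object to one of smaller index, so the union of all
  these relations generates a partial order, and by induction on \<open>r\<close> every operation on \<open>X r\<close> has a
  finite past in it. A partial order with finite pasts on a countable set extends to a linear order
  with finite pasts, and the word of the latter interleaves the words of the \<open>L r\<close>.
\<close>

text \<open>
  The witness compares two elements by the binary codes of their pasts: by antisymmetry an element is
  determined by its past, and a larger past has a larger code.
\<close>
lemma finite_past_linear_extension:
  assumes "countable A" and R: "partial_order_on A R"
    and fin: "\<And>a. a \<in> A \<Longrightarrow> finite {d. (d, a) \<in> R}"
  obtains L where "linear_order_on A L" and "R \<subseteq> L"
    and "\<And>a. a \<in> A \<Longrightarrow> finite {d. (d, a) \<in> L}"
proof -
  define past where "past a = {d. (d, a) \<in> R}" for a
  define code where "code a = set_encode (to_nat_on A ` past a)" for a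
  define L where "L = {(a, b). a \<in> A \<and> b \<in> A \<and> code a \<le> code b}"
  have RA: "R \<subseteq> A \<times> A" and refl: "\<And>a. a \<in> A \<Longrightarrow> (a, a) \<in> R"
    and "trans R" and "antisym R"
    using R by (auto simp: partial_order_on_def preorder_on_def refl_on_def)
  have pastA: "past a \<subseteq> A" for a
    using RA by (auto simp: past_def)
  have injg: "inj_on (to_nat_on A) A"
    using \<open>countable A\<close> by (rule inj_on_to_nat_on)
  have inj: "inj_on code A"
  proof (rule inj_onI)
    fix a b assume ab: "a \<in> A" "b \<in> A" and "code a = code b"
    then have "to_nat_on A ` past a = to_nat_on A ` past b"
      unfolding code_def by (metis fin finite_imageI past_def set_encode_inverse)
    then have "past a = past b"
      using injg pastA by (metis inj_on_image_eq_iff)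
    then have "(a, b) \<in> R" "(b, a) \<in> R"
      using refl ab by (auto simp: past_def)
    then show "a = b"
      using \<open>antisym R\<close> by (auto dest: antisymD)
  qed
  have mono: "code a \<le> code b" if "(a, b) \<in> R" for a b
  proof -
    have "past a \<subseteq> past b"
      using that \<open>trans R\<close> by (auto simp: past_def dest: transD)
    moreover have "finite (past b)"
      using fin that RA by (auto simp: past_def)
    ultimately show ?thesis
      unfolding code_def set_encode_def by (intro sum_mono2) auto
  qed
  have "linear_order_on A L"
    using inj unfolding linear_order_on_def partial_order_on_def preorder_on_def
    by (auto simp: L_def refl_on_def trans_def antisym_def total_on_def inj_on_def)
  moreover have "R \<subseteq> L"
    using mono RA by (auto simp: L_def)
  moreover have "finite {d. (d, a) \<in> L}" for a
  proof (rule inj_on_finite)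
    show "inj_on code {d. (d, a) \<in> L}"
      using inj by (rule inj_on_subset) (auto simp: L_def)
    show "code ` {d. (d, a) \<in> L} \<subseteq> {..code a}"
      by (auto simp: L_def)
  qed simp
  ultimately show ?thesis
    using that by blast
qed

section \<open>Numbering the events of a linear extension\<close>

text \<open>Inverse of \<open>event_at\<close>: the position, counted from 0, that the word gives to
  \<open>e\<close>. Being a plain cardinality, it avoids the definite description.\<close>

definition index :: "'e rel \<Rightarrow> 'e \<Rightarrow> nat" where
  "index L e = card {d. (d, e) \<in> L \<and> d \<noteq> e}"

lemma linear_extensionD:
  assumes "linear_extension H L"
  shows "L \<subseteq> events H \<times> events H" and "e \<in> events H \<Longrightarrow> (e, e) \<in> L"
    and "trans L" and "antisym L"
    and "\<lbrakk>a \<in> events H; b \<in> events H\<rbrakk> \<Longrightarrow> (a, b) \<in> L \<or> (b, a) \<in> L"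
    and "process_order H \<subseteq> L"
    and "e \<in> events H \<Longrightarrow> finite {d. (d, e) \<in> L}"
  using assms
  by (auto simp: linear_extension_def linear_order_on_def partial_order_on_def preorder_on_def
      refl_on_def total_on_def) metis

lemma index_less:
  assumes L: "linear_extension H L" and ab: "(a, b) \<in> L" "a \<noteq> b"
  shows "index L a < index L b"
  unfolding index_def
proof (rule psubset_card_mono)
  note * = linear_extensionD[OF L]
  have "finite {d. (d, b) \<in> L}"
    using *(1,7) ab by blast
  then show "finite {d. (d, b) \<in> L \<and> d \<noteq> b}"
    by (rule rev_finite_subset) auto
  show "{d. (d, a) \<in> L \<and> d \<noteq> a} \<subset> {d. (d, b) \<in> L \<and> d \<noteq> b}"
    using ab *(3,4) unfolding trans_def antisym_def by blast
qed

lemma index_less_iff: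
  assumes L: "linear_extension H L" and "a \<in> events H" "b \<in> events H"
  shows "index L a < index L b \<longleftrightarrow> (a, b) \<in> L \<and> a \<noteq> b"
  using index_less[OF L] linear_extensionD(5)[OF L assms(2,3)] by (metis less_asym less_irrefl)

lemma inj_on_index:
  assumes L: "linear_extension H L"
  shows "inj_on (index L) (events H)"
  using index_less[OF L] linear_extensionD(5)[OF L] by (metis inj_onI less_irrefl)

text \<open>\<open>index L\<close> injects the strict past of \<open>e\<close> into an initial
  segment of the same cardinality. Hence no index below that of \<open>e\<close> is skipped.\<close>

lemma index_image_past:
  assumes L: "linear_extension H L" and e: "e \<in> events H"
  shows "index L ` {d. (d, e) \<in> L \<and> d \<noteq> e} = {..<index L e}"
proof (rule card_subset_eq)
  let ?P = "{d. (d, e) \<in> L \<and> d \<noteq> e}"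
  show "index L ` ?P \<subseteq> {..<index L e}"
    using index_less[OF L] by auto
  have "inj_on (index L) ?P"
    using inj_on_index[OF L] linear_extensionD(1)[OF L] by (blast intro: inj_on_subset)
  then show "card (index L ` ?P) = card {..<index L e}"
    by (simp add: card_image) (simp add: index_def)
qed simp

text \<open>For finitely many events, counting suffices. For infinitely many, the set of indices is
  infinite and downward closed, hence all of \<open>UNIV\<close>.\<close>

lemma bij_betw_index:
  assumes L: "linear_extension H L"
  shows "bij_betw (index L) (events H) (positions (word_of H L))"
proof -
  let ?I = "index L ` events H"
  have down: "{..<index L e} \<subseteq> ?I" if "e \<in> events H" for e
    using index_image_past[OF L that] linear_extensionD(1)[OF L] by blast
  have "?I = positions (word_of H L)"
  proof (cases "finite (events H)")
    case True
    have "?I \<subseteq> {..<card (events H)}"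
    proof clarsimp
      fix e assume e: "e \<in> events H"
      show "index L e < card (events H)"
        unfolding index_def
        \<comment> \<open>The strict past misses \<open>e\<close> itself, so the inequality is
          strict.\<close>
        by (rule psubset_card_mono[OF True]) (use linear_extensionD(1)[OF L] e in blast)
    qed
    moreover have "card ?I = card {..<card (events H)}"
      by (simp add: card_image[OF inj_on_index[OF L]])
    ultimately show ?thesis
      using True by (simp add: word_of_def card_subset_eq)
  next
    case False
    then have "infinite ?I"
      using finite_imageD inj_on_index[OF L] by blast
    then have "n \<in> ?I" for n
      using down infinite_nat_iff_unbounded[of ?I] by blast
    then show ?thesis
      using False by (auto simp: word_of_def)
  qed
  then show ?thesis
    using inj_on_index[OF L] by (simp add: bij_betw_def)
qed

lemma event_at_index:
  assumes L: "linear_extension H L" and "e \<in> events H"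
  shows "event_at H L (index L e) = e"
  unfolding event_at_def index_def[symmetric]
  using assms(2) inj_on_index[OF L] by (auto dest: inj_onD)

text \<open>Beyond the end of a finite word \<open>letter\<close> is an out-of-range
  \<open>!\<close>, hence the restriction to positions.\<close>

lemma letter_word_of:
  assumes "n \<in> positions (word_of H L)"
  shows "letter (word_of H L) n = oper H (event_at H L n)"
  using assms by (auto simp: word_of_def split: if_splits)

lemma
  assumes L: "linear_extension H L" and n: "n \<in> positions (word_of H L)"
  shows event_at_in_events: "event_at H L n \<in> events H"
    and index_event_at: "index L (event_at H L n) = n"
  using n event_at_index[OF L] unfolding bij_betw_imp_surj_on[OF bij_betw_index[OF L], symmetric]
  by auto

theorem proposition2:
  fixes T :: "nat \<Rightarrow> ('p, 'x, 'i, 'o) seq_spec"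
    and X :: "nat \<Rightarrow> 'x"
    and H :: "('e, 'p, 'x, 'i, 'o) history"
  assumes "is_history H"
    and "inj X"
    and "\<forall>e\<in>events H. op_object (oper H e) \<in> range X"
    and "\<forall>r. subhistory H (X r) \<in> SC (T r)"
    and "\<not> (\<exists>r r' a b. a \<in> events H \<and> b \<in> events H \<and>
            op_object (oper H a) = X r \<and> op_object (oper H b) = X r' \<and>
            r > r' \<and> (a, b) \<in> process_order H)"
  shows "H \<in> SC (composition T)"
proof -
  define S where "S r = subhistory H (X r)" for r
  \<comment> \<open>As \<open>X\<close> is injective and its range covers all operations,
    \<open>obj e\<close> is the only \<open>r\<close> for which \<open>e\<close> acts on
    \<open>X r\<close>: the \<open>S r\<close> partition \<open>events H\<close>.\<close>
  define obj where "obj e = inv X (op_object (oper H e))" for e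
  have obj: "op_object (oper H e) = X r \<longleftrightarrow> obj e = r" if "e \<in> events H" for e r
    using assms(2,3) that unfolding obj_def by (metis f_inv_into_f inv_f_f)
  have eventsS: "events (S r) = {e \<in> events H. obj e = r}" for r
    using obj by (auto simp: S_def subhistory_def Let_def)
  have operS: "oper (S r) = oper H" for r
    by (simp add: S_def subhistory_def Let_def)
  have orderS: "process_order (S r) = Restr (process_order H) (events (S r))" for r
    by (simp add: S_def subhistory_def Let_def)
  have "\<forall>r. \<exists>L. linear_extension (S r) L \<and> word_of (S r) L \<in> T r"
    using assms(4) by (auto simp: SC_def S_def)
  then obtain L where L: "\<And>r. linear_extension (S r) (L r)"
    and LT: "\<And>r. word_of (S r) (L r) \<in> T r"
    by metis
  note LD = linear_extensionD[OF L, unfolded eventsS]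

  \<comment> \<open>The order generated by the process order and all the \<open>L r\<close>\<close>
  have PH: "process_order H \<subseteq> events H \<times> events H"
    and finP: "\<And>e. e \<in> events H \<Longrightarrow> finite {d. (d, e) \<in> process_order H}"
    using assms(1) by (auto simp: is_history_def partial_order_on_def preorder_on_def)
  have objP: "obj a \<le> obj b" if ab: "(a, b) \<in> process_order H" for a b
  proof (rule ccontr)
    assume "\<not> obj a \<le> obj b"
    moreover have "a \<in> events H" "b \<in> events H"
      using PH ab by auto
    moreover from this have "op_object (oper H a) = X (obj a)" "op_object (oper H b) = X (obj b)"
      by (simp_all add: obj)
    ultimately show False
      using assms(5) ab not_le by blast
  qed
  \<comment> \<open>Process order between two events on one object survives in the subhistory, which
    \<open>L\<close> extends.\<close>
  have PL: "(a, b) \<in> L (obj b)" if "(a, b) \<in> process_order H" "obj a = obj b" for a b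
    using LD(6)[of "obj b"] that PH by (auto simp: orderS eventsS)

  define R where "R = process_order H \<union> (\<Union>r. L r)"
  \<comment> \<open>\<open>R\<^sup>*\<close> is reflexive on the whole type; the intersection makes
    it a relation on \<open>events H\<close>.\<close>
  define Q where "Q = R\<^sup>* \<inter> events H \<times> events H"
  have R_step: "a \<in> events H \<and> b \<in> events H \<and>
      (obj a = obj b \<and> (a, b) \<in> L (obj b) \<or> obj a < obj b \<and> (a, b) \<in> process_order H)"
    if ab: "(a, b) \<in> R" for a b
  proof (cases "(a, b) \<in> process_order H")
    case True
    moreover have "a \<in> events H" "b \<in> events H"
      using PH True by auto
    ultimately show ?thesis
      using objP[OF True] PL[OF True] by (auto simp: le_less)
  next
    case False
    then obtain r where r: "(a, b) \<in> L r"
      using ab by (auto simp: R_def)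
    then show ?thesis
      using subsetD[OF LD(1) r] by auto
  qed
  \<comment> \<open>\<open>obj\<close> never decreases along a path. A path whose ends agree in
    \<open>obj\<close> therefore stays on that object, and transitivity of its \<open>L\<close>
    collapses it to a single pair.\<close>
  have steps: "a \<in> events H \<and> (obj a < obj b \<or> obj a = obj b \<and> (a, b) \<in> L (obj b))"
    if "(a, b) \<in> R\<^sup>*" "b \<in> events H" for a b
    using that
  proof (induction rule: converse_rtrancl_induct)
    case base
    then show ?case using LD(2) by auto
  next
    case (step a c)
    then show ?case
      using R_step[OF step(1)] transD[OF LD(3), of a c "obj b" b] by auto
  qed
  have "antisym Q"
  proof (rule antisymI)
    fix a b assume "(a, b) \<in> Q" "(b, a) \<in> Q"
    then have "(a, b) \<in> R\<^sup>*" "(b, a) \<in> R\<^sup>*" "a \<in> events H" "b \<in> events H"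
      by (simp_all add: Q_def)
    then have "(a, b) \<in> L (obj b)" "(b, a) \<in> L (obj b)"
      using steps[of a b] steps[of b a] by (metis less_asym less_irrefl)+
    then show "a = b"
      by (rule antisymD[OF LD(4)])
  qed
  moreover have "trans Q"
    unfolding Q_def by (rule trans_Int) (auto simp: trans_rtrancl intro: transI)
  ultimately have Q: "partial_order_on (events H) Q"
    by (auto simp: partial_order_on_def preorder_on_def refl_on_def Q_def)

  have finR: "finite {d. (d, e) \<in> R\<^sup>*}" if "e \<in> events H" for e
    using that
  proof (induction "obj e" arbitrary: e rule: less_induct)
    case less
    \<comment> \<open>Followed backwards from \<open>e\<close>, a path stays in \<open>?B\<close>
      until a process-order step takes it to an object of smaller index; \<open>?C\<close> collects
      the possible landing points. It is finite because \<open>?B\<close> is finite and each of its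
      members has finitely many process-order predecessors, and the induction hypothesis bounds the
      past of each landing point.\<close>
    let ?B = "{d. (d, e) \<in> L (obj e)}"
    let ?C = "{c. obj c < obj e \<and> (\<exists>b\<in>?B. (c, b) \<in> process_order H)}"
    have "finite ?B"
      using LD(7)[of e "obj e"] less.prems by simp
    moreover have "?B \<subseteq> events H"
      using LD(1) by blast
    ultimately have "finite (\<Union>b\<in>?B. {c. (c, b) \<in> process_order H})"
      using finP by blast
    then have "finite ?C"
      by (rule rev_finite_subset) auto
    moreover have "finite {d. (d, c) \<in> R\<^sup>*}" if "c \<in> ?C" for c
      using less.hyps that PH by blast
    ultimately have fin: "finite (?B \<union> (\<Union>c\<in>?C. {d. (d, c) \<in> R\<^sup>*}))"
      using \<open>finite ?B\<close> by simp
    have "d \<in> ?B \<union> (\<Union>c\<in>?C. {d. (d, c) \<in> R\<^sup>*})" if "(d, e) \<in> R\<^sup>*" for d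
      using that
    proof (induction rule: converse_rtrancl_induct)
      case base
      then show ?case using LD(2) less.prems by auto
    next
      case (step a b)
      then consider "b \<in> ?B" | c where "c \<in> ?C" "(b, c) \<in> R\<^sup>*"
        by blast
      then show ?case
      proof cases
        case 1
        then have "obj b = obj e"
          using LD(1) by blast
        then show ?thesis
          using 1 R_step[OF step(1)] transD[OF LD(3), of a b "obj e" e] by auto
      next
        case 2
        then show ?thesis
          using converse_rtrancl_into_rtrancl[OF step(1) 2(2)] by blast
      qed
    qed
    then show ?case
      by (intro finite_subset[OF _ fin] subsetI) (unfold mem_Collect_eq)
  qed
  have finQ: "finite {d. (d, e) \<in> Q}" if "e \<in> events H" for e
    using finR[OF that] by (rule rev_finite_subset) (auto simp: Q_def)

  \<comment> \<open>Each subhistory is numbered by its \<open>index\<close>, and there are countably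
    many of them.\<close>
  have "countable (events (S r))" for r
    using inj_on_index[OF L] by (rule countableI)
  moreover have "events H = (\<Union>r. events (S r))"
    by (auto simp: eventsS)
  ultimately have "countable (events H)"
    by simp
  then obtain M where "linear_order_on (events H) M" and QM: "Q \<subseteq> M"
    and "\<And>e. e \<in> events H \<Longrightarrow> finite {d. (d, e) \<in> M}"
    using finite_past_linear_extension[OF _ Q finQ] by blast
  \<comment> \<open>Through \<open>Q\<close>, \<open>M\<close> contains the process order, as a
    linear extension must, and also every \<open>L r\<close>, which later keeps the letters of each
    word in order.\<close>
  moreover have RQ: "R \<subseteq> Q"
    using R_step by (auto simp: Q_def)
  ultimately have M: "linear_extension H M"
    by (auto simp: linear_extension_def R_def)

  \<comment> \<open>The word of \<open>M\<close> as an interleaving\<close>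
  define l where "l r = word_of (S r) (L r)" for r
  \<comment> \<open>The letter occurrence \<open>(r, i)\<close> stems from the event in position
    \<open>i\<close> of \<open>L r\<close>. Its position in \<open>M\<close>,
    \<open>index M \<circ> ev\<close>, is the map required by \<open>interleaving\<close>.\<close>
  define ev where "ev = (\<lambda>(r, i). event_at (S r) (L r) i)"
  have ev: "ev (r, i) \<in> events H" "obj (ev (r, i)) = r" "index (L r) (ev (r, i)) = i"
    if "i \<in> positions (l r)" for r i
    using event_at_in_events[OF L] index_event_at[OF L] that by (auto simp: ev_def l_def eventsS)
  have "bij_betw ev (SIGMA r:UNIV. positions (l r)) (events H)"
  proof (rule bij_betw_byWitness[where f' = "\<lambda>e. (obj e, index (L (obj e)) e)"])
    show "\<forall>e\<in>events H. ev (obj e, index (L (obj e)) e) = e"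
      using event_at_index[OF L] by (auto simp: ev_def eventsS)
    show "(\<lambda>e. (obj e, index (L (obj e)) e)) ` events H \<subseteq> (SIGMA r:UNIV. positions (l r))"
      using bij_betw_index[OF L] by (auto simp: l_def eventsS bij_betw_def)
  qed (use ev in auto)
  then have "bij_betw (index M \<circ> ev) (SIGMA r:UNIV. positions (l r)) (positions (word_of H M))"
    using bij_betw_index[OF M] by (rule bij_betw_trans)
  moreover have "letter (word_of H M) ((index M \<circ> ev) (r, i)) = letter (l r) i"
    if "i \<in> positions (l r)" for r i
  proof -
    have "letter (word_of H M) (index M (ev (r, i))) = oper H (ev (r, i))"
      using bij_betwE[OF bij_betw_index[OF M]] ev(1)[OF that]
      by (simp add: letter_word_of event_at_index[OF M])
    then show ?thesis
      using that by (simp add: l_def letter_word_of operS ev_def)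
  qed
  moreover have "strict_mono_on (positions (l r)) (\<lambda>i. (index M \<circ> ev) (r, i))" for r
  proof (rule strict_mono_onI)
    fix i j assume ij: "i \<in> positions (l r)" "j \<in> positions (l r)" "i < j"
    then have "(ev (r, i), ev (r, j)) \<in> L r" "ev (r, i) \<noteq> ev (r, j)"
      using index_less_iff[OF L, of "ev (r, i)" r "ev (r, j)"] ev by (auto simp: eventsS)
    moreover have "L r \<subseteq> M"
      using RQ QM unfolding R_def by blast
    ultimately show "(index M \<circ> ev) (r, i) < (index M \<circ> ev) (r, j)"
      using index_less[OF M] by auto
  qed
  ultimately have l: "interleaving l (word_of H M)"
    unfolding interleaving_def by (intro exI[of _ "index M \<circ> ev"]) blast
  have "word_of H M \<in> composition T"
    unfolding composition_def using l LT by (auto simp: l_def intro!: exI[of _ l])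
  then show ?thesis
    using assms(1) M by (auto simp: SC_def)
qed

end
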